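(* An $n$-strand braid $\beta$ is order-preserving if and only if for every positive integer $k$ there exists a $k$-precone of the free group $F_n$ that is preserved by $\beta$.
   Context: $F_n=\langle x_1,\dots,x_n\rangle$ is the free group of rank $n$, and $B_n$ is the $n$-strand braid group with Artin generators $\sigma_1,\dots,\sigma_{n-1}$. $B_n$ acts on $F_n$ on the left by automorphisms (braid words are read from right to left, so a product of braids acts as the composition of the corresponding automorphisms, rightmost first), where $\sigma_i$ acts by $x_i\mapsto x_{i+1}$, $x_{i+1}\mapsto x_{i+1}^{-1}x_ix_{i+1}$, and $x_j\mapsto x_j$ for $j\neq i,i+1$. We write $\beta(\cdot)$ for the action of $\beta$ on elements and subsets of $F_n$. A subset $P\subset F_n$ is a (conjugation-invariant) positive cone if (1) $P\cdot P\subset P$; (2) $F_n=P\sqcup P^{-1}\sqcup\{1\}$ (disjoint union); (3) $gPg^{-1}=P$ for all $g\in F_n$. A braid $\beta\in B_n$ is order-preserving if there is a positive cone $P$ of $F_n$ with $\beta(P)=P$. For $k\ge 1$ let $W_k\subset F_n$ be the set of reduced words in $x_1,\dots,x_n$ (and their inverses) of length at most $k$. A subset $P$ is a $k$-precone of $F_n$ if (1) $(P\cdot P)\cap W_k\subset P$; (2) $W_k=P\sqcup P^{-1}\sqcup\{1\}$; (3) $(gPg^{-1})\cap W_k\subset P$ for all $g\in W_k$. A $k$-precone $P_k$ is preserved by an automorphism $\varphi$ of $F_n$ if $\varphi(P_k)\cap W_k\subset P_k$; it is preserved by a braid if it is preserved by the automorphism given by the action of that braid. *)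

theory Defs
  imports "HOL-Algebra.Coset" "HOL-Algebra.Bij"
begin

section \<open>Free groups\<close>

text \<open>
  The letter \<open>(x, True)\<close> stands for the generator \<open>x\<close> and \<open>(x, False)\<close> for its inverse.
  Elements of the free group are represented by reduced words, so the word length of an
  element is the length of the list.
\<close>

definition inv_letter :: "'a \<times> bool \<Rightarrow> 'a \<times> bool" where
  "inv_letter a = (fst a, \<not> snd a)"

definition reduced :: "('a \<times> bool) list \<Rightarrow> bool" where
  "reduced w \<longleftrightarrow> successively (\<lambda>a b. b \<noteq> inv_letter a) w"

definition push :: "'a \<times> bool \<Rightarrow> ('a \<times> bool) list \<Rightarrow> ('a \<times> bool) list" where
  "push a w = (if w \<noteq> [] \<and> hd w = inv_letter a then tl w else a # w)"

definition free_group :: "'a set \<Rightarrow> ('a \<times> bool) list monoid" where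
  "free_group S =
     \<lparr>carrier = {w. reduced w \<and> fst ` set w \<subseteq> S},
      mult = \<lambda>u v. foldr push u v,
      one = []\<rparr>"

definition free_gen :: "'a \<Rightarrow> ('a \<times> bool) list" where
  "free_gen x = [(x, True)]"

definition free_lift :: "('b, 'c) monoid_scheme \<Rightarrow> ('a \<Rightarrow> 'b) \<Rightarrow> ('a \<times> bool) list \<Rightarrow> 'b" where
  "free_lift G f w =
     foldr (\<lambda>(x, b) y. (if b then f x else inv\<^bsub>G\<^esub> f x) \<otimes>\<^bsub>G\<^esub> y) w \<one>\<^bsub>G\<^esub>"

lemma inv_letter_inv_letter [simp]: "inv_letter (inv_letter a) = a"
  by (simp add: inv_letter_def)

lemma fst_inv_letter [simp]: "fst (inv_letter a) = fst a"
  by (simp add: inv_letter_def)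

lemma reduced_Nil [simp]: "reduced []"
  by (simp add: reduced_def)

lemma reduced_push: "reduced w \<Longrightarrow> reduced (push a w)"
  by (cases w) (auto simp: reduced_def push_def successively_Cons)

lemma set_push: "fst ` set (push a w) \<subseteq> insert (fst a) (fst ` set w)"
  by (cases w) (auto simp: push_def)

lemma push_push: "reduced w \<Longrightarrow> push a (push (inv_letter a) w) = w"
  by (cases w) (auto simp: reduced_def push_def successively_Cons)

lemma reduced_foldr_push: "reduced v \<Longrightarrow> reduced (foldr push u v)"
  by (induction u) (auto simp: reduced_push)

lemma set_foldr_push: "fst ` set (foldr push u v) \<subseteq> fst ` set u \<union> fst ` set v"
proof (induction u)
  case (Cons a u)
  then show ?case using set_push[of a "foldr push u v"] by (fastforce simp: image_iff)
qed auto

lemma foldr_push_push: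
  assumes "reduced v"
  shows "foldr push (push a u) v = push a (foldr push u v)"
proof (cases "u \<noteq> [] \<and> hd u = inv_letter a")
  case True
  then obtain u' where "u = inv_letter a # u'" by (cases u) auto
  then show ?thesis
    using push_push[OF reduced_foldr_push[OF assms, of u'], of a]
    by (simp add: push_def[of a "inv_letter a # u'"])
next
  case False
  then have "push a u = a # u" by (auto simp: push_def)
  then show ?thesis by simp
qed

lemma foldr_push_assoc:
  assumes "reduced w"
  shows "foldr push (foldr push u v) w = foldr push u (foldr push v w)"
  by (induction u) (simp_all add: foldr_push_push[OF assms])

lemma foldr_push_inverse: "foldr push (map inv_letter (rev w)) w = []"
proof (induction w)
  case (Cons a w)
  have "push (inv_letter a) (a # w) = w" by (simp add: push_def)
  with Cons show ?case by simp
qed simp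

lemma foldr_push_Nil: "reduced w \<Longrightarrow> foldr push w [] = w"
proof (induction w)
  case (Cons a w)
  then have "reduced w" by (auto simp: reduced_def successively_Cons)
  with Cons show ?case
    by (cases w) (auto simp: push_def reduced_def)
qed simp

lemma reduced_inverse:
  assumes "reduced w"
  shows "reduced (map inv_letter (rev w))"
proof -
  have "successively (\<lambda>a b. inv_letter a \<noteq> b) w"
    using assms unfolding reduced_def by (rule successively_mono) auto
  then show ?thesis
    by (simp add: reduced_def successively_map)
qed

lemma group_free_group: "group (free_group S)"
proof (rule groupI)
  fix x y assume "x \<in> carrier (free_group S)" "y \<in> carrier (free_group S)"
  then show "x \<otimes>\<^bsub>free_group S\<^esub> y \<in> carrier (free_group S)"
    using subset_trans[OF set_foldr_push[of x y], of S]
    by (simp add: free_group_def reduced_foldr_push)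
next
  fix x assume x: "x \<in> carrier (free_group S)"
  have "map inv_letter (rev x) \<in> carrier (free_group S)"
    using x by (simp add: free_group_def reduced_inverse image_image)
  moreover have "map inv_letter (rev x) \<otimes>\<^bsub>free_group S\<^esub> x = \<one>\<^bsub>free_group S\<^esub>"
    by (simp add: free_group_def foldr_push_inverse)
  ultimately show "\<exists>y\<in>carrier (free_group S). y \<otimes>\<^bsub>free_group S\<^esub> x = \<one>\<^bsub>free_group S\<^esub>"
    by blast
qed (simp_all add: free_group_def foldr_push_assoc)

lemma inv_free_group:
  assumes "w \<in> carrier (free_group S)"
  shows "inv\<^bsub>free_group S\<^esub> w = map inv_letter (rev w)"
  by (rule group.inv_equality[OF group_free_group])
     (use assms in \<open>simp_all add: free_group_def foldr_push_inverse reduced_inverse image_image\<close>)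

lemma free_gen_closed: "x \<in> S \<Longrightarrow> free_gen x \<in> carrier (free_group S)"
  by (auto simp: free_group_def free_gen_def reduced_def)

context group
begin

lemma free_lift_Nil [simp]: "free_lift G f [] = \<one>"
  by (simp add: free_lift_def)

lemma free_lift_Cons:
  "free_lift G f (a # w) =
     (if snd a then f (fst a) else inv f (fst a)) \<otimes> free_lift G f w"
  by (cases a) (simp add: free_lift_def)

lemma free_lift_closed:
  assumes "f \<in> S \<rightarrow> carrier G" "fst ` set w \<subseteq> S"
  shows "free_lift G f w \<in> carrier G"
  using assms by (induction w) (auto simp: free_lift_Cons)

lemma free_lift_push:
  assumes f: "f \<in> S \<rightarrow> carrier G" and w: "fst ` set w \<subseteq> S" and a: "fst a \<in> S"
  shows "free_lift G f (push a w) = free_lift G f (a # w)"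
proof (cases "w \<noteq> [] \<and> hd w = inv_letter a")
  case True
  then obtain v where v: "w = inv_letter a # v" by (cases w) auto
  have "f (fst a) \<in> carrier G" "free_lift G f v \<in> carrier G"
    using free_lift_closed[OF f, of v] f w a v by auto
  then show ?thesis
    using v by (auto simp: push_def free_lift_Cons inv_letter_def simp flip: m_assoc)
next
  case False
  then show ?thesis by (auto simp: push_def)
qed

lemma free_lift_hom:
  assumes f: "f \<in> S \<rightarrow> carrier G"
  shows "free_lift G f \<in> hom (free_group S) G"
proof (rule homI)
  fix u v assume "u \<in> carrier (free_group S)" "v \<in> carrier (free_group S)"
  then have u: "fst ` set u \<subseteq> S" and v: "fst ` set v \<subseteq> S"
    by (auto simp: free_group_def)
  from u have "free_lift G f (foldr push u v) = free_lift G f u \<otimes> free_lift G f v"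
  proof (induction u)
    case Nil
    then show ?case using free_lift_closed[OF f v] by simp
  next
    case (Cons a u)
    have a: "fst a \<in> S" and u: "fst ` set u \<subseteq> S"
      using Cons.prems by auto
    have "fst ` set (foldr push u v) \<subseteq> S"
      by (rule subset_trans[OF set_foldr_push]) (use u v in simp)
    then have "free_lift G f (foldr push (a # u) v) =
        (if snd a then f (fst a) else inv f (fst a)) \<otimes> (free_lift G f u \<otimes> free_lift G f v)"
      using Cons.IH[OF u] free_lift_push[OF f _ a] by (simp add: free_lift_Cons)
    moreover have "f (fst a) \<in> carrier G"
      using f a by auto
    ultimately show ?case
      using free_lift_closed[OF f u] free_lift_closed[OF f v]
      by (simp add: free_lift_Cons m_assoc)
  qed
  then show "free_lift G f (u \<otimes>\<^bsub>free_group S\<^esub> v) = free_lift G f u \<otimes> free_lift G f v"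
    by (simp add: free_group_def)
qed (use free_lift_closed[OF f] in \<open>auto simp: free_group_def\<close>)

lemma free_lift_gen: "f x \<in> carrier G \<Longrightarrow> free_lift G f (free_gen x) = f x"
  by (simp add: free_gen_def free_lift_Cons)

end

lemma free_hom_eqI:
  assumes G: "group G" and h: "h \<in> hom (free_group S) G" and k: "k \<in> hom (free_group S) G"
    and eq: "\<And>x. x \<in> S \<Longrightarrow> h (free_gen x) = k (free_gen x)"
    and w: "w \<in> carrier (free_group S)"
  shows "h w = k w"
  using w
proof (induction w)
  interpret h: group_hom "free_group S" G h
    using G h group_free_group by (auto simp: group_hom_def group_hom_axioms_def)
  interpret k: group_hom "free_group S" G k
    using G k group_free_group by (auto simp: group_hom_def group_hom_axioms_def)
  case Nil
  have "[] = \<one>\<^bsub>free_group S\<^esub>" by (simp add: free_group_def)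
  then show ?case by (metis h.hom_one k.hom_one)
next
  interpret h: group_hom "free_group S" G h
    using G h group_free_group by (auto simp: group_hom_def group_hom_axioms_def)
  interpret k: group_hom "free_group S" G k
    using G k group_free_group by (auto simp: group_hom_def group_hom_axioms_def)
  case (Cons a w)
  obtain x b where a: "a = (x, b)" by fastforce
  from Cons.prems have x: "x \<in> S" and w: "w \<in> carrier (free_group S)"
    and r: "reduced (a # w)"
    by (auto simp: a free_group_def reduced_def successively_Cons)
  note gx = free_gen_closed[OF x]
  have ga: "[a] = (if b then free_gen x else inv\<^bsub>free_group S\<^esub> free_gen x)"
    by (auto simp: a inv_free_group[OF gx]) (auto simp: free_gen_def inv_letter_def)
  have hk: "h [a] = k [a]" and ac: "[a] \<in> carrier (free_group S)"
    using gx eq[OF x] by (auto simp: ga)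
  have "a # w = [a] \<otimes>\<^bsub>free_group S\<^esub> w"
    using r by (cases w) (auto simp: free_group_def push_def reduced_def)
  then show ?case
    using Cons.IH[OF w] hk ac w by simp
qed


section \<open>The braid group and its action on the free group\<close>

abbreviation Fn :: "nat \<Rightarrow> (nat \<times> bool) list monoid" where
  "Fn n \<equiv> free_group {1..n}"

definition normal_closure :: "('a, 'b) monoid_scheme \<Rightarrow> 'a set \<Rightarrow> 'a set" where
  "normal_closure G R = \<Inter>{N. N \<lhd> G \<and> R \<subseteq> N}"

definition braid_relators :: "nat \<Rightarrow> (nat \<times> bool) list set" where
  "braid_relators n =
     (let B = free_group {1..<n}; s = free_gen in
        {(s i \<otimes>\<^bsub>B\<^esub> s j) \<otimes>\<^bsub>B\<^esub> inv\<^bsub>B\<^esub> (s j \<otimes>\<^bsub>B\<^esub> s i) | i j.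
           i \<in> {1..<n} \<and> j \<in> {1..<n} \<and> i + 2 \<le> j} \<union>
        {(s i \<otimes>\<^bsub>B\<^esub> s (i + 1) \<otimes>\<^bsub>B\<^esub> s i) \<otimes>\<^bsub>B\<^esub>
           inv\<^bsub>B\<^esub> (s (i + 1) \<otimes>\<^bsub>B\<^esub> s i \<otimes>\<^bsub>B\<^esub> s (i + 1)) | i.
           i \<in> {1..<n} \<and> i + 1 \<in> {1..<n}})"

definition braid_group :: "nat \<Rightarrow> (nat \<times> bool) list set monoid" where
  "braid_group n = free_group {1..<n} Mod normal_closure (free_group {1..<n}) (braid_relators n)"

definition sigma :: "nat \<Rightarrow> nat \<Rightarrow> (nat \<times> bool) list set" where
  "sigma n i = normal_closure (free_group {1..<n}) (braid_relators n)
                 #>\<^bsub>free_group {1..<n}\<^esub> free_gen i"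

definition artin_image :: "nat \<Rightarrow> nat \<Rightarrow> nat \<Rightarrow> (nat \<times> bool) list" where
  "artin_image n i j =
     (if j = i then free_gen (i + 1)
      else if j = i + 1 then
        inv\<^bsub>Fn n\<^esub> free_gen (i + 1) \<otimes>\<^bsub>Fn n\<^esub> free_gen i \<otimes>\<^bsub>Fn n\<^esub> free_gen (i + 1)
      else free_gen j)"

definition artin_auto :: "nat \<Rightarrow> nat \<Rightarrow> (nat \<times> bool) list \<Rightarrow> (nat \<times> bool) list" where
  "artin_auto n i = restrict (free_lift (Fn n) (artin_image n i)) (carrier (Fn n))"

text \<open>
  A braid is a coset of words in the \<open>\<sigma>\<^sub>i\<close>, all of which induce the same automorphism of
  the free group. Since the product in \<^term>\<open>AutoGroup G\<close> is composition of maps, a product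
  of braids acts by the composition of the automorphisms, rightmost first; see
  \<open>braid_action_lift\<close> and \<open>braid_action_hom\<close> below.
\<close>

definition braid_action ::
    "nat \<Rightarrow> (nat \<times> bool) list set \<Rightarrow> (nat \<times> bool) list \<Rightarrow> (nat \<times> bool) list" where
  "braid_action n \<beta> = the_elem (free_lift (AutoGroup (Fn n)) (artin_auto n) ` \<beta>)"


section \<open>Positive cones and precones\<close>

definition positive_cone :: "('a, 'b) monoid_scheme \<Rightarrow> 'a set \<Rightarrow> bool" where
  "positive_cone G P \<longleftrightarrow>
     P \<subseteq> carrier G \<and>
     P <#>\<^bsub>G\<^esub> P \<subseteq> P \<and>
     carrier G = P \<union> set_inv\<^bsub>G\<^esub> P \<union> {\<one>\<^bsub>G\<^esub>} \<and>
     P \<inter> set_inv\<^bsub>G\<^esub> P = {} \<and> \<one>\<^bsub>G\<^esub> \<notin> P \<and> \<one>\<^bsub>G\<^esub> \<notin> set_inv\<^bsub>G\<^esub> P \<and>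
     (\<forall>g\<in>carrier G. (g <#\<^bsub>G\<^esub> P) #>\<^bsub>G\<^esub> inv\<^bsub>G\<^esub> g = P)"

definition order_preserving :: "nat \<Rightarrow> (nat \<times> bool) list set \<Rightarrow> bool" where
  "order_preserving n \<beta> \<longleftrightarrow> (\<exists>P. positive_cone (Fn n) P \<and> braid_action n \<beta> ` P = P)"

definition word_ball :: "nat \<Rightarrow> nat \<Rightarrow> (nat \<times> bool) list set" where
  "word_ball n k = {w \<in> carrier (Fn n). length w \<le> k}"

definition precone :: "nat \<Rightarrow> nat \<Rightarrow> (nat \<times> bool) list set \<Rightarrow> bool" where
  "precone n k P \<longleftrightarrow>
     P \<subseteq> carrier (Fn n) \<and>
     (P <#>\<^bsub>Fn n\<^esub> P) \<inter> word_ball n k \<subseteq> P \<and>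
     word_ball n k = P \<union> set_inv\<^bsub>Fn n\<^esub> P \<union> {\<one>\<^bsub>Fn n\<^esub>} \<and>
     P \<inter> set_inv\<^bsub>Fn n\<^esub> P = {} \<and> \<one>\<^bsub>Fn n\<^esub> \<notin> P \<and> \<one>\<^bsub>Fn n\<^esub> \<notin> set_inv\<^bsub>Fn n\<^esub> P \<and>
     (\<forall>g\<in>word_ball n k. ((g <#\<^bsub>Fn n\<^esub> P) #>\<^bsub>Fn n\<^esub> inv\<^bsub>Fn n\<^esub> g) \<inter> word_ball n k \<subseteq> P)"

definition precone_preserved_by ::
    "nat \<Rightarrow> nat \<Rightarrow> (nat \<times> bool) list set \<Rightarrow> ((nat \<times> bool) list \<Rightarrow> (nat \<times> bool) list) \<Rightarrow> bool" where
  "precone_preserved_by n k P \<phi> \<longleftrightarrow> \<phi> ` P \<inter> word_ball n k \<subseteq> P"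


section \<open>The action is well defined\<close>

lemma (in group) normal_closure_normal:
  assumes "R \<subseteq> carrier G"
  shows "normal_closure G R \<lhd> G"
proof -
  have "carrier G \<lhd> G"
    using subgroup_self by (auto simp: normal_inv_iff)
  then have ne: "{N. N \<lhd> G \<and> R \<subseteq> N} \<noteq> {}"
    using assms by auto
  have "subgroup (normal_closure G R) G"
    unfolding normal_closure_def
    by (rule subgroups_Inter[OF _ ne]) (auto simp: normal_imp_subgroup)
  then show ?thesis
    unfolding normal_inv_iff by (auto simp: normal_closure_def normal_inv_iff)
qed

lemma normal_closure_subset: "N \<lhd> G \<Longrightarrow> R \<subseteq> N \<Longrightarrow> normal_closure G R \<subseteq> N"
  by (auto simp: normal_closure_def)

context
  notes One_nat_def [simp del]
begin

lemma braid_relators_closed: "braid_relators n \<subseteq> carrier (free_group {1..<n})"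
proof -
  interpret group "free_group {1..<n}" by (rule group_free_group)
  have s: "free_gen i \<in> carrier (free_group {1..<n})" if "i \<in> {1..<n}" for i
    using that by (rule free_gen_closed)
  show ?thesis
    unfolding braid_relators_def Let_def by (safe; intro m_closed inv_closed s; assumption)
qed

lemma group_braid_group: "group (braid_group n)"
  unfolding braid_group_def
  by (intro normal.factorgroup_is_group group.normal_closure_normal group_free_group
      braid_relators_closed)

lemma sigma_closed: "i \<in> {1..<n} \<Longrightarrow> sigma n i \<in> carrier (braid_group n)"
  unfolding braid_group_def sigma_def carrier_FactGroup
  by (intro imageI free_gen_closed)

lemma artin_image_closed:
  assumes "i \<in> {1..<n}"
  shows "artin_image n i \<in> {1..n} \<rightarrow> carrier (Fn n)"
proof -
  interpret group "Fn n" by (rule group_free_group)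
  show ?thesis
    using assms unfolding artin_image_def
    by (auto intro!: m_closed inv_closed free_gen_closed)
qed

lemma artin_auto_hom:
  assumes "i \<in> {1..<n}"
  shows "artin_auto n i \<in> hom (Fn n) (Fn n)"
proof -
  interpret group "Fn n" by (rule group_free_group)
  show ?thesis
    using free_lift_hom[OF artin_image_closed[OF assms]]
    by (auto simp: artin_auto_def hom_def)
qed

lemma artin_auto_gen:
  assumes "i \<in> {1..<n}" "j \<in> {1..n}"
  shows "artin_auto n i (free_gen j) = artin_image n i j"
proof -
  interpret group "Fn n" by (rule group_free_group)
  have "artin_image n i j \<in> carrier (Fn n)"
    using artin_image_closed[OF assms(1)] assms(2) by auto
  then show ?thesis
    using free_gen_closed[OF assms(2)] by (simp add: artin_auto_def free_lift_gen)
qed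

lemma artin_auto_in_AutoGroup:
  assumes i: "i \<in> {1..<n}"
  shows "artin_auto n i \<in> carrier (AutoGroup (Fn n))"
proof -
  interpret group "Fn n" by (rule group_free_group)
  let ?f = "artin_auto n i"
  define g where "g = free_lift (Fn n) (\<lambda>j. if j = i + 1 then free_gen i
    else if j = i then free_gen i \<otimes>\<^bsub>Fn n\<^esub> free_gen (i + 1) \<otimes>\<^bsub>Fn n\<^esub> inv\<^bsub>Fn n\<^esub> free_gen i
    else free_gen j)"
  have gen: "free_gen j \<in> carrier (Fn n)" if "1 \<le> j" "j \<le> n" for j
    using that by (intro free_gen_closed) auto
  have i': "1 \<le> i" "i + 1 \<le> n" "i \<le> n" "1 \<le> i + 1" using i by auto
  have g_hom: "g \<in> hom (Fn n) (Fn n)"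
    unfolding g_def using i' by (intro free_lift_hom) (auto intro!: m_closed inv_closed gen)
  have f_hom: "?f \<in> hom (Fn n) (Fn n)"
    by (rule artin_auto_hom[OF i])
  interpret f: group_hom "Fn n" "Fn n" ?f
    using f_hom by unfold_locales
  interpret g: group_hom "Fn n" "Fn n" g
    using g_hom by unfold_locales
  note gi = gen[OF i'(1,3)] and gi1 = gen[OF i'(4,2)]
  have g1: "g (free_gen i) = free_gen i \<otimes>\<^bsub>Fn n\<^esub> free_gen (i + 1) \<otimes>\<^bsub>Fn n\<^esub> inv\<^bsub>Fn n\<^esub> free_gen i"
    unfolding g_def using gi gi1 by (subst free_lift_gen) auto
  have g2: "g (free_gen (i + 1)) = free_gen i"
    unfolding g_def using gi gi1 by (subst free_lift_gen) auto
  have g3: "g (free_gen j) = free_gen j" if "j \<noteq> i" "j \<noteq> i + 1" "1 \<le> j" "j \<le> n" for j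
    unfolding g_def using that gen[OF that(3,4)] by (subst free_lift_gen) auto
  have f1: "?f (free_gen i) = free_gen (i + 1)"
    using artin_auto_gen[OF i, of i] i' by (auto simp: artin_image_def)
  have f2: "?f (free_gen (i + 1)) =
      inv\<^bsub>Fn n\<^esub> free_gen (i + 1) \<otimes>\<^bsub>Fn n\<^esub> free_gen i \<otimes>\<^bsub>Fn n\<^esub> free_gen (i + 1)"
    using artin_auto_gen[OF i, of "i + 1"] i' by (auto simp: artin_image_def)
  have f3: "?f (free_gen j) = free_gen j" if "j \<noteq> i" "j \<noteq> i + 1" "1 \<le> j" "j \<le> n" for j
    using artin_auto_gen[OF i, of j] that by (auto simp: artin_image_def)
  have c: "x \<otimes>\<^bsub>Fn n\<^esub> (inv\<^bsub>Fn n\<^esub> x \<otimes>\<^bsub>Fn n\<^esub> y) = y" "inv\<^bsub>Fn n\<^esub> x \<otimes>\<^bsub>Fn n\<^esub> (x \<otimes>\<^bsub>Fn n\<^esub> y) = y"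
    if "x \<in> carrier (Fn n)" "y \<in> carrier (Fn n)" for x y
    using that by (simp_all flip: m_assoc)
  have gf: "g (?f w) = w" if w: "w \<in> carrier (Fn n)" for w
  proof -
    have "(g \<circ> ?f) w = id w"
    proof (rule free_hom_eqI[OF is_group _ _ _ w])
      fix j assume "j \<in> {1..n}"
      then show "(g \<circ> ?f) (free_gen j) = id (free_gen j)"
        using gi gi1
        by (cases "j = i"; cases "j = i + 1") (simp_all add: f1 f2 f3 g1 g2 g3 c m_assoc)
    qed (use hom_compose[OF f_hom g_hom] in \<open>auto simp: hom_def\<close>)
    then show ?thesis by simp
  qed
  have fg: "?f (g w) = w" if w: "w \<in> carrier (Fn n)" for w
  proof -
    have "(?f \<circ> g) w = id w"
    proof (rule free_hom_eqI[OF is_group _ _ _ w])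
      fix j assume "j \<in> {1..n}"
      then show "(?f \<circ> g) (free_gen j) = id (free_gen j)"
        using gi gi1
        by (cases "j = i"; cases "j = i + 1") (simp_all add: f1 f2 f3 g1 g2 g3 c m_assoc)
    qed (use hom_compose[OF g_hom f_hom] in \<open>auto simp: hom_def\<close>)
    then show ?thesis by simp
  qed
  have "bij_betw ?f (carrier (Fn n)) (carrier (Fn n))"
    by (rule bij_betw_byWitness[where f' = g]) (auto simp: fg gf)
  moreover have "?f \<in> extensional (carrier (Fn n))"
    by (simp add: artin_auto_def)
  ultimately show ?thesis
    using f_hom by (simp add: AutoGroup_def auto_def Bij_def)
qed

lemma AutoGroup_mult:
  assumes "f \<in> carrier (AutoGroup G)" "g \<in> carrier (AutoGroup G)"
  shows "f \<otimes>\<^bsub>AutoGroup G\<^esub> g = compose (carrier G) f g"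
  using assms by (simp add: AutoGroup_def BijGroup_def auto_def)

lemma AutoGroup_Fn_eqI:
  assumes "f \<in> carrier (AutoGroup (Fn n))" "g \<in> carrier (AutoGroup (Fn n))"
    and "\<And>j. j \<in> {1..n} \<Longrightarrow> f (free_gen j) = g (free_gen j)"
  shows "f = g"
proof (rule extensionalityI)
  show "f \<in> extensional (carrier (Fn n))" "g \<in> extensional (carrier (Fn n))"
    using assms by (simp_all add: AutoGroup_def auto_def Bij_def)
  show "f x = g x" if "x \<in> carrier (Fn n)" for x
    by (rule free_hom_eqI[where S = "{1..n}" and G = "Fn n"])
      (use assms that group_free_group in \<open>auto simp: AutoGroup_def auto_def\<close>)
qed

lemma artin_braid_relations:
  assumes i: "i \<in> {1..<n}" and j: "j \<in> {1..<n}"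
  shows "i + 2 \<le> j \<Longrightarrow> artin_auto n i \<otimes>\<^bsub>AutoGroup (Fn n)\<^esub> artin_auto n j =
           artin_auto n j \<otimes>\<^bsub>AutoGroup (Fn n)\<^esub> artin_auto n i"
    and "j = i + 1 \<Longrightarrow>
      artin_auto n i \<otimes>\<^bsub>AutoGroup (Fn n)\<^esub> artin_auto n j \<otimes>\<^bsub>AutoGroup (Fn n)\<^esub> artin_auto n i =
      artin_auto n j \<otimes>\<^bsub>AutoGroup (Fn n)\<^esub> artin_auto n i \<otimes>\<^bsub>AutoGroup (Fn n)\<^esub> artin_auto n j"
proof -
  interpret group "Fn n" by (rule group_free_group)
  interpret A: group "AutoGroup (Fn n)" by (rule AutoGroup)
  let ?f = "artin_auto n i" and ?g = "artin_auto n j"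
  note fA = artin_auto_in_AutoGroup[OF i] and gA = artin_auto_in_AutoGroup[OF j]
  interpret f: group_hom "Fn n" "Fn n" ?f
    using artin_auto_hom[OF i] by unfold_locales
  interpret g: group_hom "Fn n" "Fn n" ?g
    using artin_auto_hom[OF j] by unfold_locales
  have gen: "free_gen m \<in> carrier (Fn n)" if "1 \<le> m" "m \<le> n" for m
    using that by (intro free_gen_closed) auto
  have ij: "1 \<le> i" "i + 1 \<le> n" "i \<le> n" "1 \<le> i + 1" "1 \<le> j" "j + 1 \<le> n" "j \<le> n" "1 \<le> j + 1"
    using i j by auto
  note gs = gen[OF ij(1,3)] gen[OF ij(4,2)] gen[OF ij(5,7)] gen[OF ij(8,6)]
  have fm: "?f (free_gen m) = artin_image n i m" if "1 \<le> m" "m \<le> n" for m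
    using artin_auto_gen[OF i, of m] that by simp
  have gm: "?g (free_gen m) = artin_image n j m" if "1 \<le> m" "m \<le> n" for m
    using artin_auto_gen[OF j, of m] that by simp
  have c: "x \<otimes>\<^bsub>Fn n\<^esub> (inv\<^bsub>Fn n\<^esub> x \<otimes>\<^bsub>Fn n\<^esub> y) = y" "inv\<^bsub>Fn n\<^esub> x \<otimes>\<^bsub>Fn n\<^esub> (x \<otimes>\<^bsub>Fn n\<^esub> y) = y"
    if "x \<in> carrier (Fn n)" "y \<in> carrier (Fn n)" for x y
    using that by (simp_all flip: m_assoc)
  show "?f \<otimes>\<^bsub>AutoGroup (Fn n)\<^esub> ?g = ?g \<otimes>\<^bsub>AutoGroup (Fn n)\<^esub> ?f" if "i + 2 \<le> j"
  proof (rule AutoGroup_Fn_eqI)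
    fix m assume "m \<in> {1..n}"
    then have m: "1 \<le> m" "m \<le> n" by auto
    consider "m = i" | "m = i + 1" | "m = j" | "m = j + 1"
      | "m \<noteq> i" "m \<noteq> i + 1" "m \<noteq> j" "m \<noteq> j + 1" by blast
    then show "(?f \<otimes>\<^bsub>AutoGroup (Fn n)\<^esub> ?g) (free_gen m) = (?g \<otimes>\<^bsub>AutoGroup (Fn n)\<^esub> ?f) (free_gen m)"
      using that ij gs gen[OF m]
      by cases (simp_all add: AutoGroup_mult[OF fA gA] AutoGroup_mult[OF gA fA] compose_def m fm gm
          artin_image_def)
  qed (use fA gA in auto)
  show "?f \<otimes>\<^bsub>AutoGroup (Fn n)\<^esub> ?g \<otimes>\<^bsub>AutoGroup (Fn n)\<^esub> ?f =
      ?g \<otimes>\<^bsub>AutoGroup (Fn n)\<^esub> ?f \<otimes>\<^bsub>AutoGroup (Fn n)\<^esub> ?g" if "j = i + 1"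
  proof (rule AutoGroup_Fn_eqI)
    fix m assume "m \<in> {1..n}"
    then have m: "1 \<le> m" "m \<le> n" by auto
    have fgA: "?f \<otimes>\<^bsub>AutoGroup (Fn n)\<^esub> ?g \<in> carrier (AutoGroup (Fn n))"
      and gfA: "?g \<otimes>\<^bsub>AutoGroup (Fn n)\<^esub> ?f \<in> carrier (AutoGroup (Fn n))"
      using fA gA by auto
    have fgf: "(?f \<otimes>\<^bsub>AutoGroup (Fn n)\<^esub> ?g \<otimes>\<^bsub>AutoGroup (Fn n)\<^esub> ?f) x = ?f (?g (?f x))"
      and gfg: "(?g \<otimes>\<^bsub>AutoGroup (Fn n)\<^esub> ?f \<otimes>\<^bsub>AutoGroup (Fn n)\<^esub> ?g) x = ?g (?f (?g x))"
      if "x \<in> carrier (Fn n)" for x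
      unfolding AutoGroup_mult[OF fgA fA] AutoGroup_mult[OF gfA gA]
      unfolding AutoGroup_mult[OF fA gA] AutoGroup_mult[OF gA fA]
      using that by (simp_all add: compose_def)
    have ne: "i \<noteq> j" "j \<noteq> i" "i \<noteq> j + 1" "j + 1 \<noteq> i" "i + 1 = j"
      using that by auto
    consider "m = i" | "m = j" | "m = j + 1" | "m \<noteq> i" "m \<noteq> j" "m \<noteq> j + 1"
      by blast
    then show "(?f \<otimes>\<^bsub>AutoGroup (Fn n)\<^esub> ?g \<otimes>\<^bsub>AutoGroup (Fn n)\<^esub> ?f) (free_gen m) =
        (?g \<otimes>\<^bsub>AutoGroup (Fn n)\<^esub> ?f \<otimes>\<^bsub>AutoGroup (Fn n)\<^esub> ?g) (free_gen m)"
      unfolding fgf[OF gen[OF m]] gfg[OF gen[OF m]]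
      by cases (simp_all add: ne ij gs gen[OF m] m fm gm artin_image_def c m_assoc inv_mult_group)
  qed (use fA gA in auto)
qed

lemma braid_action_lift:
  "normal_closure (free_group {1..<n}) (braid_relators n) \<subseteq>
     kernel (free_group {1..<n}) (AutoGroup (Fn n)) (free_lift (AutoGroup (Fn n)) (artin_auto n))"
  (is "_ \<subseteq> kernel ?B ?A ?h")
proof -
  interpret A: group ?A by (rule group.AutoGroup[OF group_free_group])
  have f: "artin_auto n \<in> {1..<n} \<rightarrow> carrier ?A"
    using artin_auto_in_AutoGroup by blast
  interpret h: group_hom ?B ?A ?h
    using A.free_lift_hom[OF f] group_free_group
    by (auto simp: group_hom_def group_hom_axioms_def A.is_group)
  have gen: "?h (free_gen i) = artin_auto n i" "free_gen i \<in> carrier ?B"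
      "artin_auto n i \<in> carrier ?A"
    if "i \<in> {1..<n}" for i
    using f that by (auto intro!: A.free_lift_gen free_gen_closed)
  show ?thesis
  proof (rule normal_closure_subset[OF h.normal_kernel], rule subsetI)
    fix w assume w: "w \<in> braid_relators n"
    have "?h w = \<one>\<^bsub>?A\<^esub>"
      using w unfolding braid_relators_def Let_def
    proof (elim UnE CollectE exE conjE)
      fix i j assume *: "i \<in> {1..<n}" "j \<in> {1..<n}" "i + 2 \<le> j"
        and w: "w = free_gen i \<otimes>\<^bsub>?B\<^esub> free_gen j \<otimes>\<^bsub>?B\<^esub> inv\<^bsub>?B\<^esub> (free_gen j \<otimes>\<^bsub>?B\<^esub> free_gen i)"
      show "?h w = \<one>\<^bsub>?A\<^esub>"
        unfolding w using gen[OF *(1)] gen[OF *(2)] artin_braid_relations(1)[OF *] by simp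
    next
      fix i assume *: "i \<in> {1..<n}" "i + 1 \<in> {1..<n}"
        and w: "w = free_gen i \<otimes>\<^bsub>?B\<^esub> free_gen (i + 1) \<otimes>\<^bsub>?B\<^esub> free_gen i \<otimes>\<^bsub>?B\<^esub>
          inv\<^bsub>?B\<^esub> (free_gen (i + 1) \<otimes>\<^bsub>?B\<^esub> free_gen i \<otimes>\<^bsub>?B\<^esub> free_gen (i + 1))"
      show "?h w = \<one>\<^bsub>?A\<^esub>"
        unfolding w using gen[OF *(1)] gen[OF *(2)] artin_braid_relations(2)[OF * refl] by simp
    qed
    then show "w \<in> kernel ?B ?A ?h"
      using w braid_relators_closed by (auto simp: kernel_def)
  qed
qed

lemma
  shows braid_action_hom: "braid_action n \<in> hom (braid_group n) (AutoGroup (Fn n))"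
    and braid_action_sigma: "i \<in> {1..<n} \<Longrightarrow> braid_action n (sigma n i) = artin_auto n i"
proof -
  let ?B = "free_group {1..<n}" and ?A = "AutoGroup (Fn n)"
  let ?h = "free_lift ?A (artin_auto n)" and ?N = "normal_closure ?B (braid_relators n)"
  interpret A: group ?A by (rule group.AutoGroup[OF group_free_group])
  have f: "artin_auto n \<in> {1..<n} \<rightarrow> carrier ?A"
    using artin_auto_in_AutoGroup by blast
  interpret h: group_hom ?B ?A ?h
    using A.free_lift_hom[OF f] group_free_group
    by (auto simp: group_hom_def group_hom_axioms_def A.is_group)
  have N: "?N \<lhd> ?B"
    by (rule group.normal_closure_normal[OF group_free_group braid_relators_closed])
  obtain g where g: "g \<in> hom (?B Mod ?N) ?A"
    and gh: "\<And>w. w \<in> carrier ?B \<Longrightarrow> g (?N #>\<^bsub>?B\<^esub> w) = ?h w"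
    using h.FactGroup_universal_kernel[OF N braid_action_lift] by blast
  have act: "braid_action n (?N #>\<^bsub>?B\<^esub> w) = ?h w" if w: "w \<in> carrier ?B" for w
  proof -
    have "?h v = ?h w" if "v \<in> ?N #>\<^bsub>?B\<^esub> w" for v
      using that w braid_action_lift[of n] by (auto simp: r_coset_def kernel_def)
    moreover have "w \<in> ?N #>\<^bsub>?B\<^esub> w"
      using w normal_imp_subgroup[OF N] group_free_group by (metis group.rcos_self)
    ultimately have "?h ` (?N #>\<^bsub>?B\<^esub> w) = {?h w}" by blast
    then show ?thesis by (simp add: braid_action_def)
  qed
  show "braid_action n \<in> hom (braid_group n) ?A"
  proof (rule homI)
    fix x y assume x: "x \<in> carrier (braid_group n)" and y: "y \<in> carrier (braid_group n)"
    have eq: "braid_action n z = g z" if "z \<in> carrier (braid_group n)" for z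
      using that by (auto simp: braid_group_def carrier_FactGroup act gh)
    show "braid_action n x \<in> carrier ?A"
      using eq[OF x] x g by (auto simp: hom_def braid_group_def)
    show "braid_action n (x \<otimes>\<^bsub>braid_group n\<^esub> y) = braid_action n x \<otimes>\<^bsub>?A\<^esub> braid_action n y"
      using eq[OF x] eq[OF y] eq[OF monoid.m_closed[OF group.is_monoid[OF group_braid_group] x y]]
        g x y by (simp add: hom_def braid_group_def del: mult_FactGroup)
  qed
  show "braid_action n (sigma n i) = artin_auto n i" if i: "i \<in> {1..<n}"
  proof -
    have "artin_auto n i \<in> carrier ?A" using f i by blast
    then show ?thesis
      using act[OF free_gen_closed[OF i]] by (simp add: sigma_def A.free_lift_gen)
  qed
qed

end

end

theory Submission
  imports Defs "HOL-Library.Diagonal_Subsequence" "HOL-Library.Countable" "HOL-Library.Infinite_Set"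
begin

text \<open>
  Intersecting an invariant positive cone with the balls \<open>W\<^sub>k\<close> gives the precones. Conversely,
  \<open>F\<^sub>n\<close> is countable, so by a diagonal argument some subsequence of a sequence of preserved
  \<open>k\<close>-precones decides every word eventually. The words that are eventually in the precones form
  a positive cone \<open>P\<close> with \<open>\<beta>(P) \<subseteq> P\<close>, because each axiom involves only finitely many words at a
  time. As \<open>\<beta>\<close> is bijective and \<open>P\<close>, \<open>P\<^sup>-\<^sup>1\<close>, \<open>1\<close> partition \<open>F\<^sub>n\<close>, equality follows.
\<close>

section \<open>Elementwise forms of the axioms\<close>

lemma (in group) mem_set_inv_iff:
  assumes "P \<subseteq> carrier G"
  shows "x \<in> set_inv P \<longleftrightarrow> x \<in> carrier G \<and> inv x \<in> P"
  using assms unfolding SET_INV_def by force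

text \<open>Stated for any symmetric \<open>W\<close> containing \<open>\<one>\<close>, so that it
  serves both the whole group and the balls. The right-hand side tests one \<open>x\<close> at a
  time, which is what allows the axiom to pass to a limit of precones.\<close>

lemma (in group) partition_iff:
  assumes "P \<subseteq> carrier G" "W \<subseteq> carrier G" "\<one> \<in> W" "\<forall>x\<in>W. inv x \<in> W"
  shows "W = P \<union> set_inv P \<union> {\<one>} \<and> P \<inter> set_inv P = {} \<and> \<one> \<notin> P \<and> \<one> \<notin> set_inv P \<longleftrightarrow>
    P \<subseteq> W \<and> \<one> \<notin> P \<and> (\<forall>x\<in>W. x \<noteq> \<one> \<longrightarrow> (x \<in> P \<longleftrightarrow> inv x \<notin> P))"
  (is "?L \<longleftrightarrow> ?R")
proof
  assume ?L
  then show ?R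
    using assms(1,2) by (auto simp: set_eq_iff mem_set_inv_iff[OF assms(1)])
next
  assume R: ?R
  have "x \<in> P \<union> set_inv P \<union> {\<one>}" if "x \<in> W" for x
    using R that assms by (auto simp: mem_set_inv_iff[OF assms(1)])
  moreover have "x \<in> W" if "x \<in> set_inv P" for x
    using R that bspec[OF assms(4), of "inv x"] by (auto simp: mem_set_inv_iff[OF assms(1)])
  ultimately have "W = P \<union> set_inv P \<union> {\<one>}"
    using R assms(3) by blast
  moreover have "x \<notin> set_inv P" if "x \<in> P" for x
  proof -
    have "x \<in> W" "x \<noteq> \<one>"
      using R that by auto
    then show ?thesis
      using R that by (simp add: mem_set_inv_iff[OF assms(1)])
  qed
  moreover have "\<one> \<notin> set_inv P"
    using R by (simp add: mem_set_inv_iff[OF assms(1)])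
  ultimately show ?L
    using R by blast
qed

lemma (in group) positive_cone_iff:
  "positive_cone G P \<longleftrightarrow>
     P \<subseteq> carrier G \<and> \<one> \<notin> P \<and>
     (\<forall>x\<in>carrier G. x \<noteq> \<one> \<longrightarrow> (x \<in> P \<longleftrightarrow> inv x \<notin> P)) \<and>
     (\<forall>x\<in>P. \<forall>y\<in>P. x \<otimes> y \<in> P) \<and>
     (\<forall>g\<in>carrier G. \<forall>x\<in>P. g \<otimes> x \<otimes> inv g \<in> P)"
proof (cases "P \<subseteq> carrier G")
  case P: True
  have mult: "P <#> P \<subseteq> P \<longleftrightarrow> (\<forall>x\<in>P. \<forall>y\<in>P. x \<otimes> y \<in> P)"
    by (auto simp: set_mult_def)
  have conj: "(\<forall>g\<in>carrier G. (g <# P) #> inv g = P) \<longleftrightarrow>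
      (\<forall>g\<in>carrier G. \<forall>x\<in>P. g \<otimes> x \<otimes> inv g \<in> P)"
  proof
    assume R: "\<forall>g\<in>carrier G. \<forall>x\<in>P. g \<otimes> x \<otimes> inv g \<in> P"
    show "\<forall>g\<in>carrier G. (g <# P) #> inv g = P"
    proof (intro ballI equalityI subsetI)
      \<comment> \<open>The inclusions for all \<open>g\<close> already give equality: conjugating
        \<open>x\<close> by \<open>inv g\<close> stays in \<open>P\<close>, and conjugating the
        result by \<open>g\<close> returns \<open>x\<close>.\<close>
      fix g x assume g: "g \<in> carrier G" and x: "x \<in> P"
      have "inv g \<otimes> x \<otimes> inv (inv g) \<in> P"
        using R g x by blast
      moreover have "x \<in> carrier G" and "g \<otimes> (inv g \<otimes> x) = x"
        using g x P by (auto simp flip: m_assoc)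
      then have "x = g \<otimes> (inv g \<otimes> x \<otimes> inv (inv g)) \<otimes> inv g"
        using g by (simp add: m_assoc)
      ultimately show "x \<in> (g <# P) #> inv g"
        unfolding l_coset_def r_coset_def by blast
    qed (use R in \<open>auto simp: l_coset_def r_coset_def\<close>)
  qed (auto simp: l_coset_def r_coset_def)
  show ?thesis
    unfolding positive_cone_def mult conj
    using partition_iff[OF P subset_refl one_closed] P by simp argo
qed (auto simp: positive_cone_def)

lemma word_ball_inv:
  assumes "x \<in> word_ball n k"
  shows "inv\<^bsub>Fn n\<^esub> x \<in> word_ball n k"
proof -
  interpret group "Fn n" by (rule group_free_group)
  show ?thesis
    using assms inv_closed[of x] by (simp add: word_ball_def inv_free_group)
qed

text \<open>Read at fixed \<open>x\<close>, \<open>y\<close>, \<open>g\<close>, each clause involves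
  finitely many words. Once \<open>k\<close> is so large that the ball contains them all, the
  truncation has no effect and the clause is the one in \<open>positive_cone_iff\<close>.\<close>

lemma precone_iff:
  "precone n k P \<longleftrightarrow>
     P \<subseteq> word_ball n k \<and> \<one>\<^bsub>Fn n\<^esub> \<notin> P \<and>
     (\<forall>x\<in>word_ball n k. x \<noteq> \<one>\<^bsub>Fn n\<^esub> \<longrightarrow> (x \<in> P \<longleftrightarrow> inv\<^bsub>Fn n\<^esub> x \<notin> P)) \<and>
     (\<forall>x\<in>P. \<forall>y\<in>P. x \<otimes>\<^bsub>Fn n\<^esub> y \<in> word_ball n k \<longrightarrow> x \<otimes>\<^bsub>Fn n\<^esub> y \<in> P) \<and>
     (\<forall>g\<in>word_ball n k. \<forall>x\<in>P. g \<otimes>\<^bsub>Fn n\<^esub> x \<otimes>\<^bsub>Fn n\<^esub> inv\<^bsub>Fn n\<^esub> g \<in> word_ball n k \<longrightarrow>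
        g \<otimes>\<^bsub>Fn n\<^esub> x \<otimes>\<^bsub>Fn n\<^esub> inv\<^bsub>Fn n\<^esub> g \<in> P)"
proof -
  interpret group "Fn n" by (rule group_free_group)
  have W: "word_ball n k \<subseteq> carrier (Fn n)"
    by (auto simp: word_ball_def)
  show ?thesis
  proof (cases "P \<subseteq> carrier (Fn n)")
    case P: True
    have "\<one>\<^bsub>Fn n\<^esub> \<in> word_ball n k"
      unfolding word_ball_def by (auto simp: free_group_def)
    moreover have "\<forall>x\<in>word_ball n k. inv\<^bsub>Fn n\<^esub> x \<in> word_ball n k"
      using word_ball_inv by blast
    ultimately have partition: "word_ball n k = P \<union> set_inv\<^bsub>Fn n\<^esub> P \<union> {\<one>\<^bsub>Fn n\<^esub>} \<and>
        P \<inter> set_inv\<^bsub>Fn n\<^esub> P = {} \<and> \<one>\<^bsub>Fn n\<^esub> \<notin> P \<and> \<one>\<^bsub>Fn n\<^esub> \<notin> set_inv\<^bsub>Fn n\<^esub> P \<longleftrightarrow>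
        P \<subseteq> word_ball n k \<and> \<one>\<^bsub>Fn n\<^esub> \<notin> P \<and>
        (\<forall>x\<in>word_ball n k. x \<noteq> \<one>\<^bsub>Fn n\<^esub> \<longrightarrow> (x \<in> P \<longleftrightarrow> inv\<^bsub>Fn n\<^esub> x \<notin> P))"
      by (rule partition_iff[OF P W])
    have mult: "(P <#>\<^bsub>Fn n\<^esub> P) \<inter> word_ball n k \<subseteq> P \<longleftrightarrow>
        (\<forall>x\<in>P. \<forall>y\<in>P. x \<otimes>\<^bsub>Fn n\<^esub> y \<in> word_ball n k \<longrightarrow> x \<otimes>\<^bsub>Fn n\<^esub> y \<in> P)"
      by (auto simp: set_mult_def)
    have conj: "((g <#\<^bsub>Fn n\<^esub> P) #>\<^bsub>Fn n\<^esub> inv\<^bsub>Fn n\<^esub> g) \<inter> word_ball n k \<subseteq> P \<longleftrightarrow>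
        (\<forall>x\<in>P. g \<otimes>\<^bsub>Fn n\<^esub> x \<otimes>\<^bsub>Fn n\<^esub> inv\<^bsub>Fn n\<^esub> g \<in> word_ball n k \<longrightarrow>
          g \<otimes>\<^bsub>Fn n\<^esub> x \<otimes>\<^bsub>Fn n\<^esub> inv\<^bsub>Fn n\<^esub> g \<in> P)" for g
      by (auto simp: l_coset_def r_coset_def)
    show ?thesis
      unfolding precone_def mult conj using P partition by argo
  next
    case False
    with W show ?thesis by (auto simp: precone_def)
  qed
qed

section \<open>From cones to precones\<close>

lemma precone_of_positive_cone:
  assumes "positive_cone (Fn n) P"
  shows "precone n k (P \<inter> word_ball n k)"
proof -
  interpret group "Fn n" by (rule group_free_group)
  show ?thesis
    \<comment> \<open>Symmetry of the ball keeps \<open>inv x\<close> inside it, so the choice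
      between \<open>x\<close> and \<open>inv x\<close> survives the restriction.\<close>
    using assms word_ball_inv unfolding positive_cone_iff precone_iff
    by (auto simp: word_ball_def)
qed

lemma precone_preserved_of_image_eq:
  assumes "\<phi> ` P = P"
  shows "precone_preserved_by n k (P \<inter> word_ball n k) \<phi>"
  using assms by (auto simp: precone_preserved_by_def)

section \<open>From precones to a cone\<close>

text \<open>Sequential compactness of the power set of a countable type: thin the sequence out for
  one element after another, then take the diagonal.\<close>

lemma countable_diagonal:
  fixes A :: "nat \<Rightarrow> 'a::countable set"
  obtains r where "strict_mono r"
    "\<And>x. eventually (\<lambda>k. x \<in> A (r k)) sequentially \<or> eventually (\<lambda>k. x \<notin> A (r k)) sequentially"
proof -
  define Q where "Q m s \<longleftrightarrow>
    (eventually (\<lambda>k. from_nat m \<in> A (s k)) sequentially \<or>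
     eventually (\<lambda>k. from_nat m \<notin> A (s k)) sequentially)" for m and s :: "nat \<Rightarrow> nat"
  interpret subseqs Q
  proof
    fix m and s :: "nat \<Rightarrow> nat"
    assume "strict_mono s"
    show "\<exists>r. strict_mono r \<and> Q m (s \<circ> r)"
    \<comment> \<open>If only finitely many sets along \<open>s\<close> contain the element, it is
      already decided negatively; otherwise keep exactly indices at which it is contained.\<close>
    proof (cases "finite {k. from_nat m \<in> A (s k)}")
      case True
      then have "eventually (\<lambda>k. from_nat m \<notin> A (s k)) sequentially"
        by (simp flip: cofinite_eq_sequentially add: eventually_cofinite)
      then show ?thesis
        by (intro exI[of _ id]) (simp add: Q_def strict_mono_def)
    next
      case False
      then obtain r :: "nat \<Rightarrow> nat" where "strict_mono r" "\<forall>k. r k \<in> {k. from_nat m \<in> A (s k)}"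
        using infinite_enumerate by blast
      then show ?thesis
        by (intro exI[of _ r]) (simp add: Q_def)
    qed
  qed
  show thesis
  proof
    fix x :: 'a
    \<comment> \<open>The diagonal sequence runs inside the stage that decides element
      \<open>m\<close> only from index \<open>Suc m\<close> on. The shift is removed below by
      \<open>eventually_sequentially_seg\<close>.\<close>
    have "Q (to_nat x) (diagseq \<circ> (+) (Suc (to_nat x)))"
    proof (rule diagseq_holds)
      fix m and s r :: "nat \<Rightarrow> nat"
      assume "strict_mono r" "Q m s"
      then show "Q m (s \<circ> r)"
        using eventually_subseq[of r] unfolding Q_def by auto
    qed
    then show "eventually (\<lambda>k. x \<in> A (diagseq k)) sequentially \<or>
        eventually (\<lambda>k. x \<notin> A (diagseq k)) sequentially"
      unfolding Q_def[of "to_nat x"] o_def from_nat_to_nat add.commute[of "Suc _"]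
      using eventually_sequentially_seg[of "\<lambda>k. x \<in> A (diagseq k)"]
        eventually_sequentially_seg[of "\<lambda>k. x \<notin> A (diagseq k)"] by blast
  qed (rule subseq_diagseq)
qed

lemma positive_cone_of_precones:
  assumes hom: "\<phi> \<in> hom (Fn n) (Fn n)"
    and ex: "\<forall>k\<ge>1. \<exists>P. precone n k P \<and> precone_preserved_by n k P \<phi>"
  obtains P where "positive_cone (Fn n) P" "\<phi> ` P \<subseteq> P"
proof -
  interpret group "Fn n" by (rule group_free_group)
  obtain A where A: "precone n k (A k)" "precone_preserved_by n k (A k) \<phi>" if "k \<ge> 1" for k
    using ex by metis
  obtain r where r: "strict_mono r" and
    dec: "\<And>x. eventually (\<lambda>k. x \<in> A (r k)) sequentially \<or> eventually (\<lambda>k. x \<notin> A (r k)) sequentially"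
    using countable_diagonal[of A] by blast
  define P where "P = {x. eventually (\<lambda>k. x \<in> A (r k)) sequentially}"
  \<comment> \<open>\<open>seq_suble\<close> gives \<open>k \<le> r k\<close>, so the balls along
    \<open>r\<close> absorb every word.\<close>
  have ball: "eventually (\<lambda>k. x \<in> word_ball n (r k)) sequentially" if "x \<in> carrier (Fn n)" for x
    using eventually_ge_at_top[of "length x"]
    by eventually_elim (use that in \<open>auto simp: word_ball_def intro: le_trans[OF _ seq_suble[OF r]]\<close>)
  \<comment> \<open>\<open>A 0\<close> is arbitrary, so these hold only eventually;
    \<open>k \<ge> 1\<close> ensures \<open>r k \<ge> 1\<close>.\<close>
  have pre: "eventually (\<lambda>k. precone n (r k) (A (r k))) sequentially"
    and preserved: "eventually (\<lambda>k. precone_preserved_by n (r k) (A (r k)) \<phi>) sequentially"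
    using eventually_ge_at_top[of "1::nat"]
    by (eventually_elim, use A le_trans[OF _ seq_suble[OF r]] in blast)+
  have mem: "x \<in> P" if "eventually (\<lambda>k. x \<in> A (r k)) sequentially" for x
    using that by (simp add: P_def)
  have memD: "eventually (\<lambda>k. x \<in> A (r k)) sequentially" if "x \<in> P" for x
    using that by (simp add: P_def)
  \<comment> \<open>Here the choice of \<open>r\<close> enters: failing to be eventually inside
    becomes being eventually outside. Totality of \<open>P\<close> depends on this.\<close>
  have memN: "eventually (\<lambda>k. x \<notin> A (r k)) sequentially" if "x \<notin> P" for x
    using that dec[of x] by (auto simp: P_def)
  have P: "x \<in> carrier (Fn n)" if "x \<in> P" for x
  proof -
    have "eventually (\<lambda>k. x \<in> carrier (Fn n)) sequentially"
      using memD[OF that] pre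
      by eventually_elim (unfold precone_def, blast)
    then show ?thesis by simp
  qed
  have "positive_cone (Fn n) P"
    unfolding positive_cone_iff
  proof (intro conjI ballI impI subsetI notI)
    assume "\<one>\<^bsub>Fn n\<^esub> \<in> P"
    from memD[OF this] pre have "eventually (\<lambda>k::nat. False) sequentially"
      by eventually_elim (simp add: precone_def)
    then show False by simp
  next
    fix x assume x: "x \<in> carrier (Fn n)" "x \<noteq> \<one>\<^bsub>Fn n\<^esub>"
    have ev: "eventually (\<lambda>k. x \<in> A (r k) \<longleftrightarrow> inv\<^bsub>Fn n\<^esub> x \<notin> A (r k)) sequentially"
      using ball[OF x(1)] pre
      by eventually_elim (use x(2) in \<open>simp add: precone_iff\<close>)
    show "x \<in> P \<longleftrightarrow> inv\<^bsub>Fn n\<^esub> x \<notin> P"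
    proof
      assume "x \<in> P"
      show "inv\<^bsub>Fn n\<^esub> x \<notin> P"
      proof
        assume "inv\<^bsub>Fn n\<^esub> x \<in> P"
        from ev memD[OF \<open>x \<in> P\<close>] memD[OF this] have "eventually (\<lambda>k::nat. False) sequentially"
          by eventually_elim simp
        then show False by simp
      qed
    next
      assume "inv\<^bsub>Fn n\<^esub> x \<notin> P"
      show "x \<in> P"
        by (rule mem) (use ev memN[OF \<open>inv\<^bsub>Fn n\<^esub> x \<notin> P\<close>] in eventually_elim, simp)
    qed
  next
    fix x y assume xy: "x \<in> P" "y \<in> P"
    show "x \<otimes>\<^bsub>Fn n\<^esub> y \<in> P"
      by (rule mem) (use memD[OF xy(1)] memD[OF xy(2)] ball[OF m_closed[OF xy[THEN P]]] pre in
        \<open>eventually_elim, simp add: precone_iff\<close>)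
  next
    fix g x assume g: "g \<in> carrier (Fn n)" and x: "x \<in> P"
    have "g \<otimes>\<^bsub>Fn n\<^esub> x \<otimes>\<^bsub>Fn n\<^esub> inv\<^bsub>Fn n\<^esub> g \<in> carrier (Fn n)"
      by (intro m_closed inv_closed g P x)
    from memD[OF x] ball[OF g] ball[OF this] pre
    show "g \<otimes>\<^bsub>Fn n\<^esub> x \<otimes>\<^bsub>Fn n\<^esub> inv\<^bsub>Fn n\<^esub> g \<in> P"
      by (intro mem, eventually_elim) (simp add: precone_iff)
  qed (rule P)
  moreover have "\<phi> x \<in> P" if "x \<in> P" for x
  proof -
    \<comment> \<open>The image may be longer than \<open>x\<close>, so it needs its own ball bound
      before preservation puts it into \<open>A (r k)\<close>.\<close>
    have "\<phi> x \<in> carrier (Fn n)"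
      using hom P[OF that] by (auto simp: hom_def)
    from memD[OF that] ball[OF this] preserved show ?thesis
      by (intro mem, eventually_elim) (auto simp: precone_preserved_by_def)
  qed
  ultimately show thesis
    using that by blast
qed

section \<open>Equality from inclusion, and the equivalence\<close>

text \<open>If \<open>y = \<phi> x\<close> lies in \<open>P\<close> but \<open>x\<close> does not,
  totality puts \<open>inv x\<close> into \<open>P\<close>, hence also
  \<open>inv y = \<phi> (inv x)\<close>, against \<open>y \<in> P\<close>.\<close>

lemma (in group) positive_cone_image_eq:
  assumes P: "positive_cone G P" and hom: "\<phi> \<in> hom G G"
    and bij: "bij_betw \<phi> (carrier G) (carrier G)" and sub: "\<phi> ` P \<subseteq> P"
  shows "\<phi> ` P = P"
proof
  interpret \<phi>: group_hom G G \<phi>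
    using hom by unfold_locales
  show "P \<subseteq> \<phi> ` P"
  proof
    fix y assume y: "y \<in> P"
    note cone = P[unfolded positive_cone_iff]
    note carr = cone[THEN conjunct1]
    note one = cone[THEN conjunct2, THEN conjunct1]
    note total = cone[THEN conjunct2, THEN conjunct2, THEN conjunct1]
    from y carr have yc: "y \<in> carrier G" ..
    then obtain x where x: "x \<in> carrier G" "y = \<phi> x"
      using bij by (auto simp: bij_betw_def)
    \<comment> \<open>\<open>total\<close> says nothing about the identity, so both \<open>y\<close>
      and \<open>x\<close> must be shown to differ from it.\<close>
    have "y \<noteq> \<one>"
      using y one by metis
    have "x \<in> P"
    proof (rule ccontr)
      assume "x \<notin> P"
      moreover have "x \<noteq> \<one>"
        using x \<open>y \<noteq> \<one>\<close> \<phi>.hom_one by metis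
      ultimately have "inv x \<in> P"
        using total x(1) by metis
      then have "\<phi> (inv x) \<in> P"
        using sub by blast
      then have "inv y \<in> P"
        using x by simp
      then show False
        using total y yc \<open>y \<noteq> \<one>\<close> by metis
    qed
    then show "y \<in> \<phi> ` P"
      using x by blast
  qed
qed (rule sub)

theorem proposition2:
  fixes n :: nat and \<beta> :: "(nat \<times> bool) list set"
  assumes "\<beta> \<in> carrier (braid_group n)"
  shows "order_preserving n \<beta> \<longleftrightarrow>
    (\<forall>k\<ge>1. \<exists>P. precone n k P \<and> precone_preserved_by n k P (braid_action n \<beta>))"
proof
  assume "order_preserving n \<beta>"
  then obtain P where P: "positive_cone (Fn n) P" "braid_action n \<beta> ` P = P"
    unfolding order_preserving_def by blast
  show "\<forall>k\<ge>1. \<exists>P. precone n k P \<and> precone_preserved_by n k P (braid_action n \<beta>)"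
  proof (intro allI impI exI conjI)
    fix k
    show "precone n k (P \<inter> word_ball n k)"
      by (rule precone_of_positive_cone[OF P(1)])
    show "precone_preserved_by n k (P \<inter> word_ball n k) (braid_action n \<beta>)"
      by (rule precone_preserved_of_image_eq[OF P(2)])
  qed
next
  assume ex: "\<forall>k\<ge>1. \<exists>P. precone n k P \<and> precone_preserved_by n k P (braid_action n \<beta>)"
  \<comment> \<open>Membership in \<open>AutoGroup\<close> supplies both the homomorphism property
    used for the limit cone and the bijectivity that turns inclusion into equality.\<close>
  have "braid_action n \<beta> \<in> carrier (AutoGroup (Fn n))"
    using hom_in_carrier[OF braid_action_hom assms] .
  then have hom: "braid_action n \<beta> \<in> hom (Fn n) (Fn n)"
    and bij: "bij_betw (braid_action n \<beta>) (carrier (Fn n)) (carrier (Fn n))"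
    by (auto simp: AutoGroup_def auto_def Bij_def)
  obtain P where P: "positive_cone (Fn n) P" "braid_action n \<beta> ` P \<subseteq> P"
    using positive_cone_of_precones[OF hom ex] .
  then show "order_preserving n \<beta>"
    unfolding order_preserving_def
    using group.positive_cone_image_eq[OF group_free_group P(1) hom bij P(2)] by blast
qed

end
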